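(* Let $Y$ be a real Banach space and $L$ a locally compact Hausdorff topological space, where $Y$ and $C_0(L)$ have dimension at least two. If $Y$ is uniformly convex, then the pair $(C_0(L),Y)$ satisfies the BPBp-RSE for compact operators, where $C_0(L)$ is the real Banach space of real continuous functions on $L$ vanishing at infinity with the supremum norm.
   Context: All Banach spaces here are real; $B_X$, $S_X$ are the closed unit ball and unit sphere of $X$; $\mathbb T=\{1,-1\}$; $\mathcal L(X,Y)$ and $\mathcal K(X,Y)$ are the spaces of bounded and of compact linear operators. An operator $T\in\mathcal L(X,Y)$ is range strongly exposing, $T\in\mathrm{RSE}(X,Y)$, if there is $x_0\in S_X$ such that whenever $(x_n)\subseteq B_X$ satisfies $\|Tx_n\|\to\|T\|$, there are a subsequence $(x_{\sigma(n)})$ and $\lambda\in\mathbb T$ with $Tx_{\sigma(n)}\to\lambda Tx_0$. The pair $(X,Y)$ has the BPBp-RSE for compact operators (equivalently, $\mathcal K(X,Y)$ has the BPBp-RSE) if for every $\varepsilon>0$ there is $0<\eta(\varepsilon)<\varepsilon$ such that for every $T\in\mathcal K(X,Y)$ with $\|T\|=1$ and every $x\in S_X$ with $\|Tx\|>1-\eta(\varepsilon)$, there exist $S\in\mathrm{RSE}(X,Y)\cap\mathcal K(X,Y)$ and $x_0\in S_X$ with $\|S\|=\|Sx_0\|=1$, $\|S-T\|<\varepsilon$ and $\|x-x_0\|<\varepsilon$. $Y$ is uniformly convex if for every $\varepsilon>0$ there is $0<\delta<1$ such that $y_1,y_2\in S_Y$ and $\|y_1+y_2\|/2>1-\delta$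 imply $\|y_1-y_2\|<\varepsilon$. *)

theory Defs
  imports "HOL-Analysis.Analysis"
begin

section \<open>The Banach space of real continuous functions vanishing at infinity\<close>

definition vanishes_at_infinity :: "('l::topological_space \<Rightarrow> real) \<Rightarrow> bool" where
  "vanishes_at_infinity f \<longleftrightarrow>
    (\<forall>\<epsilon>>0. \<exists>K. compact K \<and> (\<forall>x. x \<notin> K \<longrightarrow> \<bar>f x\<bar> < \<epsilon>))"

text \<open>
  The space is carved out of the bounded continuous functions, from which it inherits the
  supremum norm. Boundedness is no extra restriction (see \<open>range_apply_c0\<close> below), and the
  norm is the usual one (\<open>norm_c0_eq_SUP\<close>).
\<close>

typedef (overloaded) 'l c0 =
  "{f :: 'l::topological_space \<Rightarrow>\<^sub>C real. vanishes_at_infinity (apply_bcontfun f)}"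
  morphisms bcontfun_of_c0 C0
  by (rule exI[of _ 0]) (auto simp: vanishes_at_infinity_def intro: exI[of _ "{}"])

setup_lifting type_definition_c0

definition apply_c0 :: "'l::topological_space c0 \<Rightarrow> 'l \<Rightarrow> real" where
  "apply_c0 f = apply_bcontfun (bcontfun_of_c0 f)"

declare [[coercion "apply_c0 :: 'l::topological_space c0 \<Rightarrow> 'l \<Rightarrow> real"]]

lemma vanishes_at_infinity_add:
  assumes "vanishes_at_infinity f" "vanishes_at_infinity g"
  shows "vanishes_at_infinity (\<lambda>x. f x + g x)"
  unfolding vanishes_at_infinity_def
proof (intro allI impI)
  fix e :: real assume "e > 0"
  then have "e / 2 > 0" by simp
  obtain K L where K: "compact K" "\<And>x. x \<notin> K \<Longrightarrow> \<bar>f x\<bar> < e / 2"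
    and L: "compact L" "\<And>x. x \<notin> L \<Longrightarrow> \<bar>g x\<bar> < e / 2"
    using assms \<open>e / 2 > 0\<close> unfolding vanishes_at_infinity_def by metis
  have "\<bar>f x + g x\<bar> < e" if "x \<notin> K \<union> L" for x
    using K(2)[of x] L(2)[of x] that by auto
  with K(1) L(1) show "\<exists>K. compact K \<and> (\<forall>x. x \<notin> K \<longrightarrow> \<bar>f x + g x\<bar> < e)"
    by (intro exI[of _ "K \<union> L"]) (auto intro: compact_Un)
qed

lemma vanishes_at_infinity_scale:
  assumes "vanishes_at_infinity f"
  shows "vanishes_at_infinity (\<lambda>x. c * f x)"
  unfolding vanishes_at_infinity_def
proof (intro allI impI)
  fix e :: real assume "e > 0"
  then have "e / (\<bar>c\<bar> + 1) > 0" by simp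
  then obtain K where K: "compact K" "\<And>x. x \<notin> K \<Longrightarrow> \<bar>f x\<bar> < e / (\<bar>c\<bar> + 1)"
    using assms unfolding vanishes_at_infinity_def by metis
  have "\<bar>c * f x\<bar> < e" if "x \<notin> K" for x
  proof -
    have "\<bar>c * f x\<bar> \<le> (\<bar>c\<bar> + 1) * \<bar>f x\<bar>"
      by (simp add: abs_mult mult_right_mono)
    also have "\<dots> < e"
      using K(2)[OF that] by (simp add: field_simps add_pos_nonneg)
    finally show ?thesis .
  qed
  with K(1) show "\<exists>K. compact K \<and> (\<forall>x. x \<notin> K \<longrightarrow> \<bar>c * f x\<bar> < e)" by blast
qed

lemma vanishes_at_infinity_zero: "vanishes_at_infinity (\<lambda>_. 0)"
  by (auto simp: vanishes_at_infinity_def intro: exI[of _ "{}"])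

lemma vanishes_at_infinity_minus:
  "vanishes_at_infinity f \<Longrightarrow> vanishes_at_infinity (\<lambda>x. - f x)"
  using vanishes_at_infinity_scale[of f "-1"] by simp

lemma vanishes_at_infinity_diff:
  "vanishes_at_infinity f \<Longrightarrow> vanishes_at_infinity g \<Longrightarrow> vanishes_at_infinity (\<lambda>x. f x - g x)"
  using vanishes_at_infinity_add[of f "\<lambda>x. - g x"] vanishes_at_infinity_minus[of g] by simp

lemma vanishes_at_infinity_uniform_limit:
  assumes "uniform_limit UNIV F f sequentially" "\<And>n. vanishes_at_infinity (F n)"
  shows "vanishes_at_infinity f"
  unfolding vanishes_at_infinity_def
proof (intro allI impI)
  fix e :: real assume "e > 0"
  then have e2: "e / 2 > 0" by simp
  obtain n where n: "\<And>x. dist (F n x) (f x) < e / 2"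
    using uniform_limitD[OF assms(1) e2] by (auto simp: eventually_sequentially)
  obtain K where K: "compact K" "\<And>x. x \<notin> K \<Longrightarrow> \<bar>F n x\<bar> < e / 2"
    using assms(2) e2 unfolding vanishes_at_infinity_def by metis
  have "\<bar>f x\<bar> < e" if "x \<notin> K" for x
    using K(2)[OF that] n[of x] unfolding dist_real_def by linarith
  with K(1) show "\<exists>K. compact K \<and> (\<forall>x. x \<notin> K \<longrightarrow> \<bar>f x\<bar> < e)" by blast
qed

instantiation c0 :: (topological_space) real_vector
begin

lift_definition zero_c0 :: "'a c0" is 0
  by (simp add: vanishes_at_infinity_zero)

lift_definition plus_c0 :: "'a c0 \<Rightarrow> 'a c0 \<Rightarrow> 'a c0" is "(+)"
  by (simp add: vanishes_at_infinity_add)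

lift_definition minus_c0 :: "'a c0 \<Rightarrow> 'a c0 \<Rightarrow> 'a c0" is "(-)"
  by (simp add: vanishes_at_infinity_diff)

lift_definition uminus_c0 :: "'a c0 \<Rightarrow> 'a c0" is uminus
  by (simp add: vanishes_at_infinity_minus)

lift_definition scaleR_c0 :: "real \<Rightarrow> 'a c0 \<Rightarrow> 'a c0" is scaleR
  by (simp add: vanishes_at_infinity_scale)

instance
  by standard (transfer; simp add: algebra_simps)+

end

instantiation c0 :: (topological_space) real_normed_vector
begin

lift_definition norm_c0 :: "'a c0 \<Rightarrow> real" is norm .

lift_definition dist_c0 :: "'a c0 \<Rightarrow> 'a c0 \<Rightarrow> real" is dist .

definition sgn_c0 :: "'a c0 \<Rightarrow> 'a c0" where
  "sgn_c0 f = f /\<^sub>R norm f"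

definition uniformity_c0 :: "('a c0 \<times> 'a c0) filter" where
  "uniformity_c0 = (INF e\<in>{0<..}. principal {(f, g). dist f g < e})"

definition open_c0 :: "'a c0 set \<Rightarrow> bool" where
  "open_c0 U = (\<forall>f\<in>U. \<forall>\<^sub>F (f', g) in uniformity. f' = f \<longrightarrow> g \<in> U)"

instance
proof
  fix f g :: "'a c0" and a :: real
  show "dist f g = norm (f - g)" by transfer (rule dist_norm)
  show "norm f = 0 \<longleftrightarrow> f = 0" by transfer simp
  show "norm (f + g) \<le> norm f + norm g" by transfer (rule norm_triangle_ineq)
  show "norm (a *\<^sub>R f) = \<bar>a\<bar> * norm f" by transfer simp
qed (simp_all add: sgn_c0_def uniformity_c0_def open_c0_def)

end

lemma apply_c0_simps [simp]:
  "apply_c0 0 x = 0"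
  "apply_c0 (f + g) x = apply_c0 f x + apply_c0 g x"
  "apply_c0 (f - g) x = apply_c0 f x - apply_c0 g x"
  "apply_c0 (- f) x = - apply_c0 f x"
  "apply_c0 (a *\<^sub>R f) x = a * apply_c0 f x"
  by (simp_all add: apply_c0_def zero_c0.rep_eq plus_c0.rep_eq minus_c0.rep_eq
      uminus_c0.rep_eq scaleR_c0.rep_eq)

lemma norm_c0_eq_SUP: "norm f = (SUP x. \<bar>apply_c0 f x\<bar>)"
  unfolding apply_c0_def norm_c0.rep_eq norm_bcontfun_def dist_bcontfun.rep_eq
  by simp

lemma range_apply_c0:
  "range apply_c0 = {f :: 'l::topological_space \<Rightarrow> real.
     continuous_on UNIV f \<and> vanishes_at_infinity f}"
proof (intro equalityI subsetI)
  fix f :: "'l \<Rightarrow> real" assume "f \<in> range apply_c0"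
  then show "f \<in> {f. continuous_on UNIV f \<and> vanishes_at_infinity f}"
    using bcontfun_of_c0 by (auto simp: apply_c0_def)
next
  fix f :: "'l \<Rightarrow> real" assume "f \<in> {f. continuous_on UNIV f \<and> vanishes_at_infinity f}"
  then have cont: "continuous_on UNIV f" and van: "vanishes_at_infinity f" by auto
  obtain K where K: "compact K" "\<And>x. x \<notin> K \<Longrightarrow> \<bar>f x\<bar> < 1"
    using van unfolding vanishes_at_infinity_def by (metis zero_less_one)
  have "compact (f ` K)"
    by (rule compact_continuous_image) (auto intro: continuous_on_subset[OF cont] K(1))
  then obtain B where B: "\<And>x. x \<in> K \<Longrightarrow> \<bar>f x\<bar> \<le> B"
    by (force dest!: compact_imp_bounded simp: bounded_iff)
  have "norm (f x) \<le> max B 1" for x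
    using B[of x] K(2)[of x] by (cases "x \<in> K") auto
  then have "f \<in> bcontfun" by (rule bcontfun_normI[OF cont])
  then obtain g where g: "f = apply_bcontfun g" by (rule bcontfunE)
  with van have "f = apply_c0 (C0 g)" by (simp add: apply_c0_def C0_inverse)
  then show "f \<in> range apply_c0" by simp
qed

instance c0 :: (topological_space) banach
proof
  fix F :: "nat \<Rightarrow> 'a c0"
  assume "Cauchy F"
  have "\<forall>e>0. \<exists>N. \<forall>m n x. N \<le> m \<and> N \<le> n \<and> True \<longrightarrow> dist (F m x) (F n x) < e"
  proof (intro allI impI)
    fix e :: real assume "e > 0"
    with \<open>Cauchy F\<close> obtain N where N: "\<And>m n. N \<le> m \<Longrightarrow> N \<le> n \<Longrightarrow> dist (F m) (F n) < e"
      unfolding Cauchy_def by metis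
    have "dist (F m x) (F n x) < e" if "N \<le> m" "N \<le> n" for m n x
      using N[OF that] unfolding apply_c0_def dist_c0.rep_eq by (rule dist_fun_lt_imp_dist_val_lt)
    then show "\<exists>N. \<forall>m n x. N \<le> m \<and> N \<le> n \<and> True \<longrightarrow> dist (F m x) (F n x) < e" by blast
  qed
  then obtain f where f: "\<forall>e>0. \<exists>N. \<forall>n x. N \<le> n \<and> True \<longrightarrow> dist (F n x) (f x) < e"
    unfolding uniformly_convergent_eq_cauchy[of "\<lambda>_. True" "\<lambda>n. apply_c0 (F n)", symmetric]
    by blast
  then have unif: "uniform_limit UNIV (\<lambda>n. apply_bcontfun (bcontfun_of_c0 (F n))) f sequentially"
    unfolding uniform_limit_sequentially_iff apply_c0_def by blast
  from uniform_limit_bcontfunE[OF this sequentially_bot]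
  obtain g where g: "f = apply_bcontfun g" "(\<lambda>n. bcontfun_of_c0 (F n)) \<longlonglongrightarrow> g" by metis
  have "vanishes_at_infinity f"
    using vanishes_at_infinity_uniform_limit[OF unif] bcontfun_of_c0 by blast
  then have "bcontfun_of_c0 (C0 g) = g" by (simp add: g(1) C0_inverse)
  with g(2) have "F \<longlonglongrightarrow> C0 g"
    by (simp add: tendsto_iff dist_c0.rep_eq)
  then show "convergent F" by (rule convergentI)
qed


section \<open>Operators and geometry\<close>

definition compact_operator ::
    "('x::real_normed_vector \<Rightarrow>\<^sub>L 'y::real_normed_vector) \<Rightarrow> bool" where
  "compact_operator T \<longleftrightarrow> compact (closure (blinfun_apply T ` cball 0 1))"

definition range_strongly_exposing ::
    "('x::real_normed_vector \<Rightarrow>\<^sub>L 'y::real_normed_vector) \<Rightarrow> bool" where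
  "range_strongly_exposing T \<longleftrightarrow>
    (\<exists>x0\<in>sphere 0 1. \<forall>x. (\<forall>n. x n \<in> cball 0 1) \<and> (\<lambda>n. norm (T (x n))) \<longlonglongrightarrow> norm T \<longrightarrow>
      (\<exists>\<sigma>::nat \<Rightarrow> nat. \<exists>\<theta>\<in>{1, -1::real}. strict_mono \<sigma> \<and> (\<lambda>n. T (x (\<sigma> n))) \<longlonglongrightarrow> \<theta> *\<^sub>R T x0))"

definition BPBp_RSE_compact ::
    "'x::real_normed_vector itself \<Rightarrow> 'y::real_normed_vector itself \<Rightarrow> bool" where
  "BPBp_RSE_compact X Y \<longleftrightarrow>
    (\<forall>\<epsilon>>0. \<exists>\<eta>>0. \<eta> < \<epsilon> \<and>
      (\<forall>(T :: 'x \<Rightarrow>\<^sub>L 'y) x. compact_operator T \<and> norm T = 1 \<and> x \<in> sphere 0 1 \<and> norm (T x) > 1 - \<eta> \<longrightarrow>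
        (\<exists>(S :: 'x \<Rightarrow>\<^sub>L 'y). \<exists>x0\<in>sphere 0 1. range_strongly_exposing S \<and> compact_operator S \<and>
          norm S = 1 \<and> norm (S x0) = 1 \<and> norm (S - T) < \<epsilon> \<and> norm (x - x0) < \<epsilon>)))"

definition uniformly_convex :: "'y::real_normed_vector itself \<Rightarrow> bool" where
  "uniformly_convex Y \<longleftrightarrow>
    (\<forall>\<epsilon>>0. \<exists>\<delta>::real. 0 < \<delta> \<and> \<delta> < 1 \<and>
      (\<forall>y1\<in>sphere (0::'y) 1. \<forall>y2\<in>sphere 0 1.
        norm (y1 + y2) / 2 > 1 - \<delta> \<longrightarrow> norm (y1 - y2) < \<epsilon>))"

text \<open>
  The constant \<open>dim\<close> is \<open>0\<close> on infinite-dimensional spaces, so lower bounds on the dimension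
  are expressed through linearly independent sets instead.
\<close>

definition dimension_at_least :: "nat \<Rightarrow> 'v::real_vector itself \<Rightarrow> bool" where
  "dimension_at_least n V \<longleftrightarrow> (\<exists>B :: 'v set. independent B \<and> finite B \<and> card B = n)"

end

theory Submission
  imports Defs
begin

text \<open>
  Three perturbations of an operator \<open>T\<close> on \<open>C\<^sub>0(L)\<close> give the result. Each of them either
  precomposes \<open>T\<close> with an operator on \<open>C\<^sub>0(L)\<close> or passes to a norm limit, so compactness survives.

  \<^emph>\<open>Boosting.\<close> A norm-one \<open>f\<close> attains its norm at a point \<open>t\<close>, hence \<open>\<xi> x = f t * x t\<close> is a functional
  of norm one with \<open>\<xi> f = 1\<close>. The boosted operator \<open>R x = T x + a * \<xi> x *\<^sub>R T f\<close> is within \<open>a\<close> of \<open>T\<close>.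
  If \<open>\<parallel>T f\<parallel>\<close> is almost \<open>1\<close>, then \<open>\<parallel>R f\<parallel>\<close> is almost \<open>1 + a\<close>, and the triangle inequality forces every
  \<open>w\<close> in the ball with \<open>\<parallel>R w\<parallel>\<close> that large and \<open>\<xi> w \<ge> 0\<close> to satisfy \<open>\<xi> w \<approx> 1\<close> and
  \<open>\<parallel>T w + T f\<parallel> \<approx> 2\<close> (\<open>aligned_if_boosted_norm_large\<close>). Boosting an operator that attains its norm at
  \<open>f\<close> yields, by uniform convexity, a range strongly exposing one
  (\<open>range_strongly_exposing_boost\<close>). It therefore suffices to make \<open>T\<close> attain its norm near \<open>f\<close>.

  \<^emph>\<open>Improving.\<close> Let \<open>w\<close> be a near-maximiser of \<open>R\<close>, to any prescribed accuracy. It may differ wildly from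
  \<open>f\<close>, but where it does, the midpoint \<open>(w + f)/2\<close> stays away from \<open>\<plusminus>1\<close>. Functions living there can be
  added to and subtracted from the midpoint without leaving the ball, so uniform convexity makes \<open>T\<close> small on
  them. Let \<open>\<psi>\<close> be a cutoff to this region and put \<open>E x = x + \<psi> (\<xi> x *\<^sub>R w - x)\<close>, a contraction.
  Then \<open>R \<circ> E\<close> is close to \<open>T\<close>, and a function \<open>x\<^sub>0\<close> close to \<open>f\<close>, equal to \<open>w\<close> where \<open>\<psi> \<noteq> 1\<close>,
  has \<open>E x\<^sub>0 = w\<close> once \<open>\<xi> w = 1\<close> holds exactly, which a truncation of \<open>2w\<close> achieves
  (\<open>stretched_maximiser\<close>). So, up to rescaling, \<open>R \<circ> E\<close> nearly attains its norm at \<open>x\<^sub>0\<close>, now with the prescribed accuracy, although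
  the size of the perturbation depends only on the initial accuracy (\<open>improve_norming\<close>).

  \<^emph>\<open>Iterating.\<close> Repeating this with geometrically decreasing perturbations, the operators and the points
  converge, and the limit operator attains its norm at the limit point
  (\<open>norm_attainment_by_iteration\<close>).
\<close>

section \<open>Uniform convexity in the ball\<close>

lemma norm_normalized_diff:
  fixes y :: "'y::real_normed_vector"
  assumes "norm y \<le> 1" "y \<noteq> 0"
  shows "norm (y - y /\<^sub>R norm y) = 1 - norm y"
proof -
  have "y - y /\<^sub>R norm y = (1 - inverse (norm y)) *\<^sub>R y"
    by (simp add: algebra_simps)
  then have "norm (y - y /\<^sub>R norm y) = \<bar>1 - inverse (norm y)\<bar> * norm y"
    by simp
  also have "\<dots> = (inverse (norm y) - 1) * norm y"
    using assms by (subst abs_of_nonpos) (auto simp: field_simps)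
  also have "\<dots> = 1 - norm y"
    using assms by (simp add: field_simps)
  finally show ?thesis .
qed

text \<open>
  In the ball, a sum of norm close to \<open>2\<close> forces both summands to have norm close to \<open>1\<close>, so normalising
  them changes little.
\<close>

lemma uniformly_convex_on_ball:
  assumes "uniformly_convex TYPE('y::real_normed_vector)" "e > 0"
  obtains d where "d > 0"
    "\<And>a b :: 'y. norm a \<le> 1 \<Longrightarrow> norm b \<le> 1 \<Longrightarrow> norm (a + b) > 2 - d \<Longrightarrow> norm (a - b) < e"
proof -
  obtain \<delta> where \<delta>: "0 < \<delta>" "\<delta> < 1"
    "\<And>y1 y2 :: 'y. norm y1 = 1 \<Longrightarrow> norm y2 = 1 \<Longrightarrow> norm (y1 + y2) / 2 > 1 - \<delta> \<Longrightarrow> norm (y1 - y2) < e / 2"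
    using assms(1)[unfolded uniformly_convex_def, rule_format, of "e / 2"] assms(2) by auto
  define d where "d = min (\<delta> / 3) (e / 8)"
  have d: "0 < d" "d \<le> \<delta> / 3" "d \<le> e / 8"
    using \<delta> assms(2) by (auto simp: d_def)
  show thesis
  proof (rule that[OF d(1)])
    fix a b :: 'y
    assume a: "norm a \<le> 1" and b: "norm b \<le> 1" and ab: "norm (a + b) > 2 - d"
    have tri: "norm (a + b) \<le> norm a + norm b" by (rule norm_triangle_ineq)
    have a1: "norm a > 1 - d" and b1: "norm b > 1 - d"
      using tri a b ab by linarith+
    have "a \<noteq> 0" "b \<noteq> 0" using a1 b1 d \<delta> by auto
    define a' b' where "a' = a /\<^sub>R norm a" and "b' = b /\<^sub>R norm b"
    have na: "norm (a - a') < d" and nb: "norm (b - b') < d"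
      using norm_normalized_diff[OF a \<open>a \<noteq> 0\<close>] norm_normalized_diff[OF b \<open>b \<noteq> 0\<close>] a1 b1
      by (auto simp: a'_def b'_def)
    have "norm (a + b) \<le> norm (a' + b') + (norm (a - a') + norm (b - b'))"
      using norm_triangle_ineq[of "a' + b'" "(a - a') + (b - b')"]
        norm_triangle_ineq[of "a - a'" "b - b'"] by (simp add: algebra_simps)
    then have "norm (a' + b') / 2 > 1 - \<delta>"
      using ab na nb d \<delta> by argo
    then have "norm (a' - b') < e / 2"
      using \<delta>(3)[of a' b'] \<open>a \<noteq> 0\<close> \<open>b \<noteq> 0\<close> by (simp add: a'_def b'_def)
    moreover have "norm (a - b) \<le> norm (a' - b') + (norm (a - a') + norm (b - b'))"
      using norm_triangle_ineq[of "a' - b'" "(a - a') - (b - b')"]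
        norm_triangle_ineq4[of "a - a'" "b - b'"] by (simp add: algebra_simps)
    ultimately show "norm (a - b) < e"
      using na nb d by argo
  qed
qed


section \<open>Compact operators\<close>

text \<open>The right factor maps the unit ball into a multiple of the unit ball.\<close>

lemma compact_operator_compose:
  fixes T :: "'x::real_normed_vector \<Rightarrow>\<^sub>L 'y::real_normed_vector"
    and G :: "'z::real_normed_vector \<Rightarrow>\<^sub>L 'x"
  assumes "compact_operator T"
  shows "compact_operator (T o\<^sub>L G)"
proof -
  define c where "c = norm G + 1"
  have c: "c > 0" by (simp add: c_def add_nonneg_pos)
  let ?K = "(*\<^sub>R) c ` closure (T ` cball 0 1)"
  have K: "compact ?K"
    using assms compact_scaling unfolding compact_operator_def by blast
  have "(T o\<^sub>L G) x \<in> ?K" if x: "x \<in> cball 0 1" for x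
  proof -
    have "norm (G x) \<le> norm G * norm x" by (rule norm_blinfun)
    also have "\<dots> \<le> norm G * 1" using x by (intro mult_left_mono) auto
    finally have "norm (G x /\<^sub>R c) \<le> 1"
      using c by (simp add: c_def field_simps)
    then have "T (G x /\<^sub>R c) \<in> closure (T ` cball 0 1)"
      using closure_subset by fastforce
    then have "c *\<^sub>R T (G x /\<^sub>R c) \<in> ?K" by blast
    then show ?thesis using c by (simp add: blinfun.scaleR_right)
  qed
  then have "closure ((T o\<^sub>L G) ` cball 0 1) \<subseteq> ?K"
    by (intro closure_minimal compact_imp_closed[OF K]) auto
  with compact_Int_closed[OF K closed_closure] show ?thesis
    unfolding compact_operator_def by (metis inf.absorb_iff2)
qed

text \<open>
  Total boundedness of the image of the ball passes to norm limits; completeness of the codomain turns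
  it into compactness of the closure.
\<close>

lemma closed_compact_operators:
  "closed {T :: 'x::real_normed_vector \<Rightarrow>\<^sub>L 'y::banach. compact_operator T}"
  unfolding closed_sequential_limits
proof (intro allI impI, elim conjE)
  fix F and T :: "'x \<Rightarrow>\<^sub>L 'y"
  assume F: "\<forall>n. F n \<in> {T. compact_operator T}" and lim: "F \<longlonglongrightarrow> T"
  have "\<exists>k. finite k \<and> closure (T ` cball 0 1) \<subseteq> (\<Union>y\<in>k. ball y e)" if "e > 0" for e
  proof -
    have "e / 3 > 0" using \<open>e > 0\<close> by simp
    from LIMSEQ_D[OF lim this] obtain n where n: "norm (F n - T) < e / 3" by blast
    have "compact (closure (F n ` cball 0 1))"
      using F by (simp add: compact_operator_def)
    then have "\<exists>k. finite k \<and> closure (F n ` cball 0 1) \<subseteq> (\<Union>y\<in>k. ball y (e / 3))"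
      using \<open>e / 3 > 0\<close> by (simp only: compact_eq_totally_bounded)
    then obtain k where k: "finite k" "closure (F n ` cball 0 1) \<subseteq> (\<Union>y\<in>k. ball y (e / 3))"
      by blast
    have "T x \<in> (\<Union>y\<in>k. cball y (2 * e / 3))" if x: "x \<in> cball 0 1" for x
    proof -
      have "F n x \<in> closure (F n ` cball 0 1)" by (intro subsetD[OF closure_subset] imageI x)
      with k(2) have "F n x \<in> (\<Union>y\<in>k. ball y (e / 3))" by (rule subsetD)
      then obtain y where y: "y \<in> k" "dist y (F n x) < e / 3" by auto
      have "norm (F n x - T x) \<le> norm (F n - T) * norm x"
        using norm_blinfun[of "F n - T" x] by (simp add: blinfun.diff_left)
      also have "\<dots> \<le> norm (F n - T) * 1" using x by (intro mult_left_mono) auto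
      finally have "dist (F n x) (T x) < e / 3" using n by (simp add: dist_norm)
      then have "dist y (T x) \<le> 2 * e / 3"
        using y(2) dist_triangle[of y "T x" "F n x"] by argo
      then show ?thesis using y(1) by auto
    qed
    then have "closure (T ` cball 0 1) \<subseteq> (\<Union>y\<in>k. cball y (2 * e / 3))"
      by (intro closure_minimal closed_UN k(1)) auto
    also have "\<dots> \<subseteq> (\<Union>y\<in>k. ball y e)"
      using \<open>e > 0\<close> by (intro UN_mono) auto
    finally show ?thesis using k(1) by blast
  qed
  moreover have "complete (closure (T ` cball 0 1))" by (simp add: complete_eq_closed)
  ultimately show "T \<in> {T. compact_operator T}"
    unfolding mem_Collect_eq compact_operator_def compact_eq_totally_bounded by blast
qed


section \<open>Boosting an operator in one direction\<close>

text \<open>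
  Boosting is a precomposition rather than an addition to \<open>T\<close>: \<open>T \<circ> boost a f \<xi>\<close> sends \<open>x\<close> to
  \<open>T x + a * \<xi> x *\<^sub>R T f\<close>, and as a composite it inherits compactness from \<open>T\<close>.
\<close>

definition boost :: "real \<Rightarrow> 'x::real_normed_vector \<Rightarrow> ('x \<Rightarrow>\<^sub>L real) \<Rightarrow> 'x \<Rightarrow>\<^sub>L 'x" where
  "boost a f \<xi> = id_blinfun + a *\<^sub>R (blinfun_scaleR_left f o\<^sub>L \<xi>)"

lemma boost_apply: "boost a f \<xi> x = x + (a * \<xi> x) *\<^sub>R f"
  by (simp add: boost_def blinfun.add_left blinfun.scaleR_left)

lemma functional_abs_le:
  fixes \<xi> :: "'x::real_normed_vector \<Rightarrow>\<^sub>L real"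
  assumes "norm \<xi> \<le> 1"
  shows "\<bar>\<xi> x\<bar> \<le> norm x"
  using norm_blinfun[of \<xi> x] mult_right_mono[OF assms norm_ge_zero[of x]] by simp

lemma norm_boosted_apply_le:
  fixes T :: "'x::real_normed_vector \<Rightarrow>\<^sub>L 'y::real_normed_vector"
  assumes "norm (T f) \<le> 1" "norm \<xi> \<le> 1" "0 \<le> a"
  shows "norm ((T o\<^sub>L boost a f \<xi>) x) \<le> norm (T x) + a * norm x"
proof -
  have "norm ((T o\<^sub>L boost a f \<xi>) x) \<le> norm (T x) + (a * \<bar>\<xi> x\<bar>) * norm (T f)"
    using norm_triangle_ineq[of "T x" "(a * \<xi> x) *\<^sub>R T f"] assms(3)
    by (simp add: boost_apply blinfun.add_right blinfun.scaleR_right abs_mult)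
  also have "(a * \<bar>\<xi> x\<bar>) * norm (T f) \<le> (a * norm x) * 1"
    by (intro mult_mono functional_abs_le assms mult_left_mono) (auto simp: assms)
  finally show ?thesis by simp
qed

lemma norm_boosted_diff_le:
  fixes T :: "'x::real_normed_vector \<Rightarrow>\<^sub>L 'y::real_normed_vector"
  assumes "norm (T f) \<le> 1" "norm \<xi> \<le> 1" "0 \<le> a"
  shows "norm ((T o\<^sub>L boost a f \<xi>) - T) \<le> a"
proof (rule norm_blinfun_bound[OF assms(3)])
  fix x
  have "norm (((T o\<^sub>L boost a f \<xi>) - T) x) = (a * \<bar>\<xi> x\<bar>) * norm (T f)"
    using assms(3)
    by (simp add: boost_apply blinfun.add_right blinfun.scaleR_right blinfun.diff_left abs_mult)
  also have "\<dots> \<le> (a * norm x) * 1"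
    by (intro mult_mono functional_abs_le assms mult_left_mono) (auto simp: assms)
  finally show "norm (((T o\<^sub>L boost a f \<xi>) - T) x) \<le> a * norm x" by simp
qed

text \<open>
  With \<open>p = T x\<close>, \<open>q = T f\<close> and \<open>r = \<xi> x\<close> the large vector is the image of \<open>x\<close> under the boosted
  operator. Since its norm is at most \<open>1 + a r\<close>, the scalar \<open>r\<close> has to be near \<open>1\<close>; and since \<open>p + a q\<close> is
  \<open>a (p + q)\<close> plus a vector of norm at most \<open>1 - a\<close>, the sum \<open>p + q\<close> has to be nearly as long as possible.
\<close>

lemma aligned_if_boosted_norm_large:
  fixes p q :: "'y::real_normed_vector"
  assumes p: "norm p \<le> 1" and q: "norm q \<le> 1" and a: "0 < a" "a \<le> 1" and r: "0 \<le> r" "r \<le> 1"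
    and large: "norm (p + (a * r) *\<^sub>R q) > 1 + a - e"
  shows "1 - r < e / a" and "norm (p + q) > 2 - 2 * e / a"
proof -
  have "norm (p + (a * r) *\<^sub>R q) \<le> norm p + (a * r) * norm q"
    using norm_triangle_ineq[of p "(a * r) *\<^sub>R q"] a r by simp
  also have "\<dots> \<le> 1 + a * r"
    using p mult_left_mono[OF q, of "a * r"] a r by (intro add_mono) (auto simp: mult_ac)
  finally have ar: "a * (1 - r) < e" using large by (simp add: algebra_simps)
  then show "1 - r < e / a" using a by (simp add: field_simps)
  have split: "p + (a * r) *\<^sub>R q = a *\<^sub>R (p + q) + ((1 - a) *\<^sub>R p - (a * (1 - r)) *\<^sub>R q)"
    by (simp add: algebra_simps)
  have "norm (p + (a * r) *\<^sub>R q)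
      \<le> norm (a *\<^sub>R (p + q)) + (norm ((1 - a) *\<^sub>R p) + norm ((a * (1 - r)) *\<^sub>R q))"
    unfolding split using norm_triangle_ineq[of "a *\<^sub>R (p + q)" "(1 - a) *\<^sub>R p - (a * (1 - r)) *\<^sub>R q"]
      norm_triangle_ineq4[of "(1 - a) *\<^sub>R p" "(a * (1 - r)) *\<^sub>R q"] by linarith
  also have "\<dots> \<le> a * norm (p + q) + ((1 - a) * 1 + (a * (1 - r)) * 1)"
    using a r p q by (intro add_mono) (auto intro!: mult_left_mono mult_left_le simp: abs_mult)
  finally have "2 * a - 2 * e < a * norm (p + q)" using large ar by argo
  then show "norm (p + q) > 2 - 2 * e / a" using a by (simp add: field_simps)
qed

lemma norm_boost_attaining:
  fixes S :: "'x::real_normed_vector \<Rightarrow>\<^sub>L 'y::real_normed_vector"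
    and \<xi> :: "'x \<Rightarrow>\<^sub>L real"
  assumes S: "norm S = 1" "norm x0 = 1" "norm (S x0) = 1" and \<xi>: "norm \<xi> \<le> 1" "\<xi> x0 = 1"
    and a: "0 < a"
  shows "norm (S o\<^sub>L boost a x0 \<xi>) = 1 + a"
    and "norm ((S o\<^sub>L boost a x0 \<xi>) x0) = 1 + a"
proof -
  let ?R = "S o\<^sub>L boost a x0 \<xi>"
  have "?R x0 = (1 + a) *\<^sub>R S x0"
    by (simp add: boost_apply \<xi> blinfun.add_right blinfun.scaleR_right algebra_simps)
  then show Rx0: "norm (?R x0) = 1 + a" using S a by simp
  have "norm ?R \<le> 1 + a"
  proof (rule norm_blinfun_bound)
    fix x
    show "norm (?R x) \<le> (1 + a) * norm x"
      using norm_boosted_apply_le[of S x0 \<xi> a x] norm_blinfun[of S x] S \<xi> a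
      by (simp add: algebra_simps)
  qed (use a in simp)
  moreover have "1 + a \<le> norm ?R" using norm_blinfun[of ?R x0] Rx0 S by simp
  ultimately show "norm ?R = 1 + a" by simp
qed

text \<open>
  A maximising sequence of the boosted operator, after multiplication by the sign of \<open>\<xi>\<close>, satisfies
  \<open>\<parallel>S (z n) + S x0\<parallel> \<longlonglongrightarrow> 2\<close> by \<open>aligned_if_boosted_norm_large\<close>, so \<open>S (z n) \<longlonglongrightarrow> S x0\<close> by uniform
  convexity. The subsequence serves only to make that sign constant.
\<close>

lemma range_strongly_exposing_boost:
  fixes S :: "'x::real_normed_vector \<Rightarrow>\<^sub>L 'y::real_normed_vector"
    and \<xi> :: "'x \<Rightarrow>\<^sub>L real"
  assumes uc: "uniformly_convex TYPE('y)"
    and S: "norm S = 1" "norm x0 = 1" "norm (S x0) = 1" and \<xi>: "norm \<xi> \<le> 1" "\<xi> x0 = 1"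
    and a: "0 < a" "a \<le> 1"
  shows "range_strongly_exposing (S o\<^sub>L boost a x0 \<xi>)"
proof -
  let ?R = "S o\<^sub>L boost a x0 \<xi>"
  have nR: "norm ?R = 1 + a" by (rule norm_boost_attaining(1)[OF S \<xi> a(1)])
  have "\<exists>\<sigma>::nat \<Rightarrow> nat. \<exists>\<theta>\<in>{1, -1::real}. strict_mono \<sigma> \<and> (\<lambda>n. ?R (x (\<sigma> n))) \<longlonglongrightarrow> \<theta> *\<^sub>R ?R x0"
    if x: "\<And>n. norm (x n) \<le> 1" and lim: "(\<lambda>n. norm (?R (x n))) \<longlonglongrightarrow> norm ?R" for x :: "nat \<Rightarrow> 'x"
  proof -
    define s where "s n = (if \<xi> (x n) \<ge> 0 then 1 else -1 :: real)" for n
    \<comment> \<open>One of the two signs occurs infinitely often.\<close>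
    have "\<exists>\<theta>\<in>{1, -1}. infinite {n. s n = \<theta>}"
    proof (rule ccontr)
      assume "\<not> ?thesis"
      then have "finite ({n. s n = 1} \<union> {n. s n = -1})" by simp
      moreover have "{n. s n = 1} \<union> {n. s n = -1} = UNIV" by (auto simp: s_def)
      ultimately show False by simp
    qed
    then obtain \<theta> where \<theta>: "\<theta> \<in> {1, -1}" "infinite {n. s n = \<theta>}" by blast
    define \<sigma> where "\<sigma> = enumerate {n. s n = \<theta>}"
    have \<sigma>: "strict_mono \<sigma>" unfolding \<sigma>_def by (rule strict_mono_enumerate[OF \<theta>(2)])
    have s\<sigma>: "s (\<sigma> n) = \<theta>" for n using enumerate_in_set[OF \<theta>(2), of n] by (simp add: \<sigma>_def)
    define z where "z n = \<theta> *\<^sub>R x (\<sigma> n)" for n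
    have nz: "norm (z n) \<le> 1" for n using x \<theta> by (auto simp: z_def)
    have \<xi>z: "0 \<le> \<xi> (z n)" "\<xi> (z n) \<le> 1" for n
      using s\<sigma>[of n] functional_abs_le[OF \<xi>(1), of "z n"] nz[of n]
      by (auto simp: z_def s_def blinfun.scaleR_right split: if_splits)
    have nSz: "norm (S (z n)) \<le> 1" for n
      using norm_blinfun[of S "z n"] S nz[of n] by simp
    have "norm (?R (z n)) = norm (?R (x (\<sigma> n)))" for n
      using \<theta>(1) unfolding z_def blinfun.scaleR_right by auto
    then have limz: "(\<lambda>n. norm (?R (z n))) \<longlonglongrightarrow> 1 + a"
      using LIMSEQ_subseq_LIMSEQ[OF lim \<sigma>] nR by (simp add: o_def)
    have Rz: "?R (z n) = S (z n) + (a * \<xi> (z n)) *\<^sub>R S x0" for n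
      by (simp add: boost_apply blinfun.add_right blinfun.scaleR_right)
    have Sz: "(\<lambda>n. S (z n)) \<longlonglongrightarrow> S x0"
    proof (rule LIMSEQ_I)
      fix e :: real assume "e > 0"
      obtain d where d: "d > 0" "\<And>p q :: 'y. norm p \<le> 1 \<Longrightarrow> norm q \<le> 1 \<Longrightarrow> norm (p + q) > 2 - d \<Longrightarrow> norm (p - q) < e"
        using uniformly_convex_on_ball[OF uc \<open>e > 0\<close>] by metis
      have "a * d / 2 > 0" using a d by simp
      then obtain N where N: "\<And>n. n \<ge> N \<Longrightarrow> norm (norm (?R (z n)) - (1 + a)) < a * d / 2"
        using LIMSEQ_D[OF limz] by blast
      have "norm (S (z n) - S x0) < e" if "n \<ge> N" for n
      proof (rule d(2)[OF nSz])
        have "norm (S (z n) + (a * \<xi> (z n)) *\<^sub>R S x0) > 1 + a - a * d / 2"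
          using N[OF that] unfolding Rz real_norm_def by argo
        from aligned_if_boosted_norm_large(2)[OF nSz _ a \<xi>z this]
        show "norm (S (z n) + S x0) > 2 - d" using S a by simp
      qed (use S in simp)
      then show "\<exists>N. \<forall>n\<ge>N. norm (S (z n) - S x0) < e" by blast
    qed
    have "(\<lambda>n. \<xi> (z n)) \<longlonglongrightarrow> 1"
    proof (rule LIMSEQ_I)
      fix e :: real assume "e > 0"
      then have "a * e > 0" using a by simp
      then obtain N where N: "\<And>n. n \<ge> N \<Longrightarrow> norm (norm (?R (z n)) - (1 + a)) < a * e"
        using LIMSEQ_D[OF limz] by blast
      have "norm (\<xi> (z n) - 1) < e" if "n \<ge> N" for n
      proof -
        have "norm (S (z n) + (a * \<xi> (z n)) *\<^sub>R S x0) > 1 + a - a * e"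
          using N[OF that] unfolding Rz real_norm_def by argo
        from aligned_if_boosted_norm_large(1)[OF nSz _ a \<xi>z this]
        show ?thesis using S a \<xi>z[of n] by simp
      qed
      then show "\<exists>N. \<forall>n\<ge>N. norm (\<xi> (z n) - 1) < e" by blast
    qed
    then have "(\<lambda>n. ?R (z n)) \<longlonglongrightarrow> S x0 + (a * 1) *\<^sub>R S x0"
      unfolding Rz by (intro tendsto_intros Sz)
    then have "(\<lambda>n. ?R (z n)) \<longlonglongrightarrow> ?R x0"
      by (simp add: boost_apply blinfun.add_right blinfun.scaleR_right \<xi>)
    then have "(\<lambda>n. \<theta> *\<^sub>R ?R (z n)) \<longlonglongrightarrow> \<theta> *\<^sub>R ?R x0"
      by (rule tendsto_scaleR[OF tendsto_const])
    moreover have "\<theta> *\<^sub>R ?R (z n) = ?R (x (\<sigma> n))" for n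
      using \<theta>(1) unfolding z_def blinfun.scaleR_right by auto
    ultimately show ?thesis using \<sigma> \<theta>(1) by auto
  qed
  then show ?thesis
    unfolding range_strongly_exposing_def using S(2) by (intro bexI[of _ x0]) auto
qed

lemma norm_rescale_le:
  fixes R T :: "'v::real_normed_vector"
  assumes "norm T = 1" "norm (R - T) \<le> c" "R \<noteq> 0"
  shows "norm (R /\<^sub>R norm R - T) \<le> 2 * c"
proof -
  have "R /\<^sub>R norm R - R = (inverse (norm R) - 1) *\<^sub>R R" by (simp add: algebra_simps)
  then have "norm (R /\<^sub>R norm R - R) = \<bar>(inverse (norm R) - 1) * norm R\<bar>" by (simp add: abs_mult)
  also have "\<dots> = \<bar>1 - norm R\<bar>" using assms(3) by (simp add: algebra_simps)
  also have "\<dots> \<le> c" using assms(2) norm_triangle_ineq3[of R T] assms(1) by simp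
  finally show ?thesis
    using norm_triangle_ineq[of "R /\<^sub>R norm R - R" "R - T"] assms(2) by simp
qed

lemma range_strongly_exposing_scaleR:
  fixes R :: "'x::real_normed_vector \<Rightarrow>\<^sub>L 'y::real_normed_vector"
  assumes "range_strongly_exposing R" "c \<noteq> 0"
  shows "range_strongly_exposing (c *\<^sub>R R)"
  unfolding range_strongly_exposing_def
proof -
  obtain x0 where x0: "x0 \<in> sphere 0 1" and R: "\<And>x. (\<forall>n. x n \<in> cball 0 1) \<Longrightarrow>
      (\<lambda>n. norm (R (x n))) \<longlonglongrightarrow> norm R \<Longrightarrow>
      \<exists>\<sigma>::nat \<Rightarrow> nat. \<exists>\<theta>\<in>{1, -1::real}. strict_mono \<sigma> \<and> (\<lambda>n. R (x (\<sigma> n))) \<longlonglongrightarrow> \<theta> *\<^sub>R R x0"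
    using assms(1) unfolding range_strongly_exposing_def by metis
  have "\<exists>\<sigma>::nat \<Rightarrow> nat. \<exists>\<theta>\<in>{1, -1::real}. strict_mono \<sigma> \<and>
      (\<lambda>n. (c *\<^sub>R R) (x (\<sigma> n))) \<longlonglongrightarrow> \<theta> *\<^sub>R (c *\<^sub>R R) x0"
    if x: "\<forall>n. x n \<in> cball 0 1" and lim: "(\<lambda>n. norm ((c *\<^sub>R R) (x n))) \<longlonglongrightarrow> norm (c *\<^sub>R R)" for x
  proof -
    have "(\<lambda>n. norm (R (x n))) \<longlonglongrightarrow> norm R"
      using tendsto_mult_left[OF lim, of "inverse \<bar>c\<bar>"] assms(2)
      by (simp add: blinfun.scaleR_left)
    from R[OF x this] obtain \<sigma> \<theta> where "strict_mono \<sigma>" "\<theta> \<in> {1, -1::real}"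
      and l: "(\<lambda>n. R (x (\<sigma> n))) \<longlonglongrightarrow> \<theta> *\<^sub>R R x0" by blast
    moreover have "(\<lambda>n. (c *\<^sub>R R) (x (\<sigma> n))) \<longlonglongrightarrow> \<theta> *\<^sub>R (c *\<^sub>R R) x0"
      using tendsto_scaleR[OF tendsto_const[of c] l] by (simp add: blinfun.scaleR_left mult.commute)
    ultimately show ?thesis by blast
  qed
  with x0 show "\<exists>x0\<in>sphere 0 1. \<forall>x. (\<forall>n. x n \<in> cball 0 1) \<and>
      (\<lambda>n. norm ((c *\<^sub>R R) (x n))) \<longlonglongrightarrow> norm (c *\<^sub>R R) \<longrightarrow>
      (\<exists>\<sigma>::nat \<Rightarrow> nat. \<exists>\<theta>\<in>{1, -1::real}. strict_mono \<sigma> \<and>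
        (\<lambda>n. (c *\<^sub>R R) (x (\<sigma> n))) \<longlonglongrightarrow> \<theta> *\<^sub>R (c *\<^sub>R R) x0)"
    by blast
qed

section \<open>Passing to the limit\<close>

lemma limit_of_geometric_steps:
  fixes z :: "nat \<Rightarrow> 'v::banach"
  assumes "\<And>n. norm (z (Suc n) - z n) \<le> c * (1/2) ^ n"
  obtains l where "z \<longlonglongrightarrow> l" "norm (l - z 0) \<le> 2 * c"
proof -
  have geo: "(\<lambda>n. c * (1/2) ^ n) sums (c * 2)"
    using sums_mult[OF geometric_sums[of "1/2::real"], of c] by simp
  have sm: "summable (\<lambda>n. z (Suc n) - z n)"
    by (rule summable_comparison_test'[OF sums_summable[OF geo], of 0]) (use assms in auto)
  let ?s = "\<Sum>n. z (Suc n) - z n"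
  have "(\<lambda>n. \<Sum>i<n. z (Suc i) - z i) \<longlonglongrightarrow> ?s"
    by (rule summable_LIMSEQ[OF sm])
  then have "(\<lambda>n. z n - z 0) \<longlonglongrightarrow> ?s" by (simp add: sum_lessThan_telescope)
  from tendsto_add[OF this tendsto_const[of "z 0"]]
  have "z \<longlonglongrightarrow> ?s + z 0" by simp
  moreover have "norm ?s \<le> (\<Sum>n. c * (1/2) ^ n)"
    by (rule norm_suminf_le[OF assms sums_summable[OF geo]])
  then have "norm (?s + z 0 - z 0) \<le> 2 * c"
    using sums_unique[OF geo] by simp
  ultimately show thesis by (rule that)
qed

text \<open>
  The accuracy \<open>\<eta>'\<close> in the hypothesis is arbitrary while the distance \<open>e\<close> is controlled by the accuracy of
  the given pair alone. Each step can thus prepare the next one, whose distance is half as large.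
\<close>

lemma norm_attainment_by_iteration:
  fixes P :: "('x::banach \<Rightarrow>\<^sub>L 'y::banach) \<Rightarrow> bool"
  assumes closed: "closed {T. P T}"
    and improve: "\<And>e. e > 0 \<Longrightarrow> \<exists>\<eta>>0. \<forall>T x. P T \<and> norm T = 1 \<and> norm x = 1 \<and> norm (T x) > 1 - \<eta> \<longrightarrow>
      (\<forall>\<eta>'>0. \<exists>S y. P S \<and> norm S = 1 \<and> norm y = 1 \<and> norm (S y) > 1 - \<eta>' \<and>
        norm (S - T) < e \<and> norm (y - x) < e)"
    and e: "e > 0"
  shows "\<exists>\<eta>>0. \<forall>T x. P T \<and> norm T = 1 \<and> norm x = 1 \<and> norm (T x) > 1 - \<eta> \<longrightarrow>
      (\<exists>S y. P S \<and> norm S = 1 \<and> norm y = 1 \<and> norm (S y) = 1 \<and>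
        norm (S - T) < e \<and> norm (y - x) < e)"
proof -
  obtain h where h: "\<And>e. e > 0 \<Longrightarrow> h e > 0"
    and step: "\<And>e T x \<eta>'. e > 0 \<Longrightarrow> P T \<Longrightarrow> norm T = 1 \<Longrightarrow> norm x = 1 \<Longrightarrow> norm (T x) > 1 - h e \<Longrightarrow>
      \<eta>' > 0 \<Longrightarrow> \<exists>S y. P S \<and> norm S = 1 \<and> norm y = 1 \<and> norm (S y) > 1 - \<eta>' \<and>
        norm (S - T) < e \<and> norm (y - x) < e"
    using improve by metis
  define \<epsilon> where "\<epsilon> n = e / 8 * (1/2) ^ n" for n :: nat
  define \<eta> where "\<eta> n = min (h (\<epsilon> n)) ((1/2) ^ n)" for n
  have \<epsilon>: "\<epsilon> n > 0" for n using e by (simp add: \<epsilon>_def)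
  have \<eta>: "\<eta> n > 0" for n using h[OF \<epsilon>[of n]] by (simp add: \<eta>_def)
  define good where "good n p \<longleftrightarrow> P (fst p) \<and> norm (fst p) = 1 \<and> norm (snd p) = 1 \<and>
      norm (blinfun_apply (fst p) (snd p)) > 1 - \<eta> n" for n and p :: "('x \<Rightarrow>\<^sub>L 'y) \<times> 'x"
  define near where "near n p q \<longleftrightarrow> norm (fst q - fst p) < \<epsilon> n \<and> norm (snd q - snd p) < \<epsilon> n"
    for n and p q :: "('x \<Rightarrow>\<^sub>L 'y) \<times> 'x"
  have "\<exists>S y. P S \<and> norm S = 1 \<and> norm y = 1 \<and> norm (S y) = 1 \<and> norm (S - T) < e \<and> norm (y - x) < e"
    if T: "P T" "norm T = 1" "norm x = 1" "norm (T x) > 1 - \<eta> 0" for T x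
  proof -
    have "\<exists>f. \<forall>n. (good n (f n) \<and> (n = 0 \<longrightarrow> f n = (T, x))) \<and> near n (f n) (f (Suc n))"
    proof (rule dependent_nat_choice)
      show "\<exists>p. good 0 p \<and> (0 = (0::nat) \<longrightarrow> p = (T, x))" using T by (auto simp: good_def)
      fix p n assume "good n p \<and> (n = 0 \<longrightarrow> p = (T, x))"
      then have "\<exists>S y. P S \<and> norm S = 1 \<and> norm y = 1 \<and> norm (S y) > 1 - \<eta> (Suc n) \<and>
        norm (S - fst p) < \<epsilon> n \<and> norm (y - snd p) < \<epsilon> n"
        by (intro step \<epsilon> \<eta>) (auto simp: good_def \<eta>_def)
      then show "\<exists>q. (good (Suc n) q \<and> (Suc n = 0 \<longrightarrow> q = (T, x))) \<and> near n p q"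
        by (auto simp: good_def near_def)
    qed
    then obtain f where f: "\<And>n. good n (f n)" "f 0 = (T, x)" "\<And>n. near n (f n) (f (Suc n))"
      by metis
    obtain S where S: "(\<lambda>n. fst (f n)) \<longlonglongrightarrow> S" "norm (S - T) \<le> 2 * (e / 8)"
      using limit_of_geometric_steps[of "\<lambda>n. fst (f n)" "e / 8"] f(2,3)
      unfolding near_def \<epsilon>_def by (auto simp: less_imp_le)
    obtain y where y: "(\<lambda>n. snd (f n)) \<longlonglongrightarrow> y" "norm (y - x) \<le> 2 * (e / 8)"
      using limit_of_geometric_steps[of "\<lambda>n. snd (f n)" "e / 8"] f(2,3)
      unfolding near_def \<epsilon>_def by (auto simp: less_imp_le)
    have "P S"
      using closed f(1) S(1) unfolding closed_sequential_limits good_def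
      by (metis (mono_tags, lifting) mem_Collect_eq)
    have nS: "norm S = 1"
      using tendsto_norm[OF S(1)] f(1) by (simp add: good_def LIMSEQ_const_iff)
    have ny: "norm y = 1"
      using tendsto_norm[OF y(1)] f(1) by (simp add: good_def LIMSEQ_const_iff)
    have "(\<lambda>n. norm (blinfun_apply (fst (f n)) (snd (f n)))) \<longlonglongrightarrow> norm (S y)"
      by (intro tendsto_norm blinfun.tendsto S y)
    moreover have "(\<lambda>n. norm (blinfun_apply (fst (f n)) (snd (f n)))) \<longlonglongrightarrow> 1"
    proof (rule tendsto_sandwich[OF always_eventually always_eventually])
      show "\<forall>n. 1 - (1/2) ^ n \<le> norm (blinfun_apply (fst (f n)) (snd (f n)))"
      proof
        fix n
        have "\<eta> n \<le> (1/2) ^ n" by (simp add: \<eta>_def)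
        then show "1 - (1/2) ^ n \<le> norm (blinfun_apply (fst (f n)) (snd (f n)))"
          using f(1)[of n] unfolding good_def by linarith
      qed
      show "\<forall>n. norm (blinfun_apply (fst (f n)) (snd (f n))) \<le> 1"
      proof
        fix n
        show "norm (blinfun_apply (fst (f n)) (snd (f n))) \<le> 1"
          using norm_blinfun[of "fst (f n)" "snd (f n)"] f(1)[of n] by (simp add: good_def)
      qed
      show "(\<lambda>n. 1 - (1/2) ^ n) \<longlonglongrightarrow> (1::real)"
        by (rule tendsto_eq_intros LIMSEQ_power_zero | simp)+
      show "(\<lambda>n. 1) \<longlonglongrightarrow> (1::real)" by simp
    qed
    ultimately have "norm (S y) = 1" by (rule LIMSEQ_unique)
    with \<open>P S\<close> nS ny S(2) y(2) e show ?thesis by (intro exI[of _ S] exI[of _ y]) simp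
  qed
  then show ?thesis using \<eta>[of 0] by blast
qed

section \<open>Functions vanishing at infinity\<close>

lemma c0_abs_le_norm: "\<bar>apply_c0 f t\<bar> \<le> norm f"
  using norm_bounded[of "bcontfun_of_c0 f" t] by (simp add: apply_c0_def norm_c0.rep_eq)

lemma c0_norm_le: "(\<And>t. \<bar>apply_c0 f t\<bar> \<le> B) \<Longrightarrow> norm f \<le> B"
  using norm_bound[of "bcontfun_of_c0 f" B] by (simp add: apply_c0_def norm_c0.rep_eq)

lemma c0_eqI: "(\<And>t. apply_c0 f t = apply_c0 g t) \<Longrightarrow> f = g"
  by (simp add: apply_c0_def bcontfun_of_c0_inject[symmetric] bcontfun_eqI)

lemma continuous_on_c0 [continuous_intros]: "continuous_on A (apply_c0 f)"
  unfolding apply_c0_def by simp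

lemma vanishes_at_infinity_c0: "vanishes_at_infinity (apply_c0 f)"
  using range_apply_c0 by blast

text \<open>All functions built below are dominated by a multiple of one that is already in \<open>C\<^sub>0(L)\<close>.\<close>

lemma c0_of_dominated:
  fixes g :: "'l::topological_space c0"
  assumes "continuous_on UNIV h" "\<And>t. \<bar>h t\<bar> \<le> M * \<bar>apply_c0 g t\<bar>"
  obtains k where "\<And>t. apply_c0 k t = h t"
proof -
  have "vanishes_at_infinity h"
    unfolding vanishes_at_infinity_def
  proof (intro allI impI)
    fix e :: real assume "e > 0"
    with vanishes_at_infinity_scale[OF vanishes_at_infinity_c0[of g], of M]
    obtain K where "compact K" "\<And>t. t \<notin> K \<Longrightarrow> \<bar>M * apply_c0 g t\<bar> < e"
      unfolding vanishes_at_infinity_def by metis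
    moreover have "\<bar>h t\<bar> \<le> \<bar>M * apply_c0 g t\<bar>" for t
      using assms(2)[of t] abs_ge_self[of M] mult_right_mono[of M "\<bar>M\<bar>" "\<bar>apply_c0 g t\<bar>"]
      by (simp add: abs_mult)
    ultimately show "\<exists>K. compact K \<and> (\<forall>t. t \<notin> K \<longrightarrow> \<bar>h t\<bar> < e)"
      by (meson order_le_less_trans)
  qed
  with assms(1) have "h \<in> range apply_c0" by (simp add: range_apply_c0)
  then show thesis using that by auto
qed

lemma c0_norm_attained:
  fixes f :: "'l::topological_space c0"
  assumes "f \<noteq> 0"
  obtains t where "\<bar>apply_c0 f t\<bar> = norm f"
proof -
  have "norm f / 2 > 0" using assms by simp
  then obtain K where K: "compact K" "\<And>t. t \<notin> K \<Longrightarrow> \<bar>apply_c0 f t\<bar> < norm f / 2"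
    using vanishes_at_infinity_c0[of f] unfolding vanishes_at_infinity_def by metis
  have "K \<noteq> {}"
  proof
    assume "K = {}"
    then have "norm f \<le> norm f / 2" using K(2) by (intro c0_norm_le) (auto simp: less_imp_le)
    with \<open>norm f / 2 > 0\<close> show False by simp
  qed
  obtain t where t: "\<And>s. s \<in> K \<Longrightarrow> \<bar>apply_c0 f s\<bar> \<le> \<bar>apply_c0 f t\<bar>"
    using continuous_attains_sup[OF K(1) \<open>K \<noteq> {}\<close>, of "\<lambda>s. \<bar>apply_c0 f s\<bar>"]
    by (auto intro: continuous_intros)
  have "norm f \<le> max \<bar>apply_c0 f t\<bar> (norm f / 2)"
    by (rule c0_norm_le) (use t K(2) in \<open>force simp: le_max_iff_disj\<close>)
  with \<open>norm f / 2 > 0\<close> c0_abs_le_norm[of f t] show thesis by (intro that[of t]) linarith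
qed

definition c0_eval :: "'l::topological_space \<Rightarrow> 'l c0 \<Rightarrow>\<^sub>L real" where
  "c0_eval t = Blinfun (\<lambda>f. apply_c0 f t)"

lemma c0_eval_apply [simp]: "c0_eval t f = apply_c0 f t"
  unfolding c0_eval_def
  by (subst bounded_linear_Blinfun_apply)
    (auto intro!: bounded_linear_intro[of _ 1] c0_abs_le_norm)

text \<open>
  An evaluation at a point, and not just some norming functional, is what allows the value of the
  functional at a near-maximiser to be corrected to exactly \<open>1\<close> in \<open>stretched_maximiser\<close>.
\<close>

lemma norming_evaluation:
  fixes f :: "'l::topological_space c0"
  assumes "norm f = 1"
  obtains t s where "\<bar>s\<bar> = 1" "s * apply_c0 f t = 1" "norm (s *\<^sub>R c0_eval t) \<le> 1"
proof -
  have "f \<noteq> 0" using assms by auto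
  then obtain t where t: "\<bar>apply_c0 f t\<bar> = 1" using c0_norm_attained assms by metis
  have "norm (c0_eval t) \<le> 1"
    by (rule norm_blinfun_bound) (auto simp: c0_abs_le_norm)
  then show thesis using t by (intro that[of "apply_c0 f t" t]) (auto simp: abs_mult_self_eq abs_if split: if_splits)
qed

lemma c0_multiplier:
  fixes \<psi> :: "'l::topological_space \<Rightarrow> real"
  assumes "continuous_on UNIV \<psi>" "\<And>t. 0 \<le> \<psi> t" "\<And>t. \<psi> t \<le> 1"
  obtains D :: "'l c0 \<Rightarrow>\<^sub>L 'l c0" where "\<And>x t. apply_c0 (D x) t = \<psi> t * apply_c0 x t"
proof -
  have le: "\<bar>\<psi> t * r\<bar> \<le> \<bar>r\<bar>" for t r
    using assms by (simp add: abs_mult mult_left_le_one_le)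
  have "\<exists>y. \<forall>t. apply_c0 y t = \<psi> t * apply_c0 x t" for x :: "'l c0"
  proof -
    have "continuous_on UNIV (\<lambda>t. \<psi> t * apply_c0 x t)"
      by (intro continuous_intros assms(1))
    then show ?thesis by (rule c0_of_dominated[of _ 1 x]) (use le in auto)
  qed
  then obtain D where D: "\<And>x t. apply_c0 (D x) t = \<psi> t * apply_c0 x t" by metis
  have "bounded_linear D"
  proof (rule bounded_linear_intro[of _ 1])
    show "norm (D x) \<le> norm x * 1" for x
    proof (rule c0_norm_le)
      show "\<bar>apply_c0 (D x) t\<bar> \<le> norm x * 1" for t
        using le[of t "apply_c0 x t"] c0_abs_le_norm[of x t] by (simp add: D)
    qed
  qed (auto intro!: c0_eqI simp: D algebra_simps)
  then show thesis using that[of "Blinfun D"] D by (simp add: bounded_linear_Blinfun_apply)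
qed

section \<open>The improvement step\<close>

lemma near_maximiser_exists:
  fixes R :: "'x::real_normed_vector \<Rightarrow>\<^sub>L 'y::real_normed_vector"
  assumes "\<tau> > 0"
  obtains u where "norm u \<le> 1" "norm (R u) > norm R - \<tau>"
proof (rule ccontr)
  assume "\<not> thesis"
  with that have le: "\<And>u. norm u \<le> 1 \<Longrightarrow> norm (R u) \<le> norm R - \<tau>" by (meson not_less)
  have pos: "0 \<le> norm R - \<tau>" using le[of 0] by simp
  have "norm R \<le> norm R - \<tau>"
  proof (rule norm_blinfun_bound[OF pos])
    fix x
    show "norm (R x) \<le> (norm R - \<tau>) * norm x"
    proof (cases "x = 0")
      case False
      then show ?thesis using le[of "x /\<^sub>R norm x"] by (simp add: blinfun.scaleR_right field_simps)
    qed simp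
  qed
  with assms show False by simp
qed

text \<open>
  For the truncation \<open>w\<close> of \<open>2u\<close> to \<open>[-1, 1]\<close>, both \<open>w\<close> and \<open>2u - w\<close> lie in the ball, and \<open>u\<close> is their
  midpoint. Near-maximality of \<open>u\<close> therefore passes to \<open>w\<close>, whose values are exactly \<open>\<plusminus>1\<close> wherever those
  of \<open>u\<close> were at least \<open>1/2\<close> in absolute value. The exact value is needed because \<open>\<xi> x\<^sub>0\<close> must
  equal \<open>1\<close>, not just approximately, for \<open>E x\<^sub>0 = w\<close> to hold in \<open>improve_norming\<close>.
\<close>

lemma stretched_maximiser:
  fixes R :: "'l::topological_space c0 \<Rightarrow>\<^sub>L 'y::real_normed_vector"
  assumes u: "norm u \<le> 1"
  obtains w where "norm w \<le> 1" "norm (R w) \<ge> 2 * norm (R u) - norm R"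
    "\<And>t s. \<bar>s\<bar> = 1 \<Longrightarrow> s * apply_c0 u t \<ge> 1/2 \<Longrightarrow> s * apply_c0 w t = 1"
proof -
  obtain w where w: "\<And>t. apply_c0 w t = max (-1) (min 1 (2 * apply_c0 u t))"
    by (rule c0_of_dominated[of "\<lambda>t. max (-1) (min 1 (2 * apply_c0 u t))" 2 u])
      (auto intro!: continuous_intros)
  have u1: "\<bar>apply_c0 u t\<bar> \<le> 1" for t using c0_abs_le_norm[of u t] u by linarith
  have nw: "norm w \<le> 1" by (rule c0_norm_le) (auto simp: w)
  have "norm (2 *\<^sub>R u - w) \<le> 1"
    by (rule c0_norm_le, use u1 in \<open>simp add: w abs_if min_def max_def\<close>)
      (smt (verit) u1)
  then have "norm (R (2 *\<^sub>R u - w)) \<le> norm R"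
    using norm_blinfun[of R "2 *\<^sub>R u - w"] mult_left_le[of "norm (2 *\<^sub>R u - w)" "norm R"] by simp
  moreover have "2 * norm (R u) \<le> norm (R w) + norm (R (2 *\<^sub>R u - w))"
    using norm_triangle_ineq[of "R w" "R (2 *\<^sub>R u - w)"]
    by (simp add: blinfun.diff_right blinfun.scaleR_right)
  ultimately have "norm (R w) \<ge> 2 * norm (R u) - norm R" by linarith
  moreover have "s * apply_c0 w t = 1" if "\<bar>s\<bar> = 1" "s * apply_c0 u t \<ge> 1/2" for t s
    using that by (auto simp: w abs_if split: if_splits)
  ultimately show thesis using nw that by blast
qed

text \<open>
  The alignment of \<open>T w\<close> with \<open>T f\<close> depends on \<open>\<eta>\<close> and \<open>a\<close> only, whereas the accuracy \<open>\<eta>'\<close> with which \<open>w\<close>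
  maximises the boosted operator is free.
\<close>

lemma aligned_boosted_near_maximiser:
  fixes T :: "'l::topological_space c0 \<Rightarrow>\<^sub>L 'y::real_normed_vector"
  assumes T: "norm T = 1" and f: "norm f = 1" "norm (T f) > 1 - \<eta>"
    and s: "\<bar>s\<bar> = 1" "s * apply_c0 f t0 = 1" "norm (s *\<^sub>R c0_eval t0) \<le> 1"
    and a: "0 < a" "a \<le> 1" and \<eta>: "0 < \<eta>" "\<eta> \<le> a / 8" and \<eta>': "\<eta>' > 0"
  defines "R \<equiv> T o\<^sub>L boost a f (s *\<^sub>R c0_eval t0)"
  obtains w where "norm w \<le> 1" "s * apply_c0 w t0 = 1" "norm (T w + T f) > 2 - 4 * \<eta> / a"
    "norm (R w) > (1 - \<eta>') * norm R"
proof -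
  let ?\<xi> = "s *\<^sub>R c0_eval t0"
  have \<xi>: "?\<xi> x = s * apply_c0 x t0" for x by (simp add: blinfun.scaleR_left)
  have R: "R x = T x + (a * (s * apply_c0 x t0)) *\<^sub>R T f" for x
    by (simp add: R_def boost_apply \<xi> blinfun.add_right blinfun.scaleR_right)
  have nT: "norm (T x) \<le> norm x" for x using norm_blinfun[of T x] T by simp
  have \<xi>1: "\<bar>s * apply_c0 x t0\<bar> \<le> norm x" for x
    using s(1) c0_abs_le_norm[of x t0] by (simp add: abs_mult)
  have "R f = (1 + a) *\<^sub>R T f" by (simp add: R s algebra_simps)
  then have "norm (R f) = (1 + a) * norm (T f)" using a by simp
  moreover have "(1 + a) * (1 - \<eta>) < (1 + a) * norm (T f)" using f a by simp
  moreover have "1 + a - 2 * \<eta> \<le> (1 + a) * (1 - \<eta>)"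
    using a \<eta> mult_right_mono[of a 1 \<eta>] by (simp add: algebra_simps)
  ultimately have N: "norm R > 1 + a - 2 * \<eta>" using norm_blinfun[of R f] f(1) by simp
  \<comment> \<open>Stretching doubles the defect of a near-maximiser, hence the bounds on \<open>2 * \<tau>\<close>; the bound
      \<open>\<eta>' / 8\<close> leaves room for \<open>norm R\<close> being only known to be at least \<open>1/4\<close>.\<close>
  define \<tau> where "\<tau> = min ((norm R - (1 + a - 2 * \<eta>)) / 2) (\<eta>' / 8)"
  have \<tau>: "\<tau> > 0" "2 * \<tau> \<le> norm R - (1 + a - 2 * \<eta>)" "2 * \<tau> \<le> \<eta>' / 4"
    subgoal using N \<eta>' by (simp add: \<tau>_def)
    subgoal using min.cobounded1[of "(norm R - (1 + a - 2 * \<eta>)) / 2" "\<eta>' / 8"] by (simp add: \<tau>_def)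
    subgoal using min.cobounded2[of "(norm R - (1 + a - 2 * \<eta>)) / 2" "\<eta>' / 8"] by (simp add: \<tau>_def)
    done
  obtain u0 where u0: "norm u0 \<le> 1" "norm (R u0) > norm R - \<tau>"
    using near_maximiser_exists[OF \<tau>(1)] by metis
  define u where "u = (if s * apply_c0 u0 t0 \<ge> 0 then u0 else - u0)"
  have u: "norm u \<le> 1" "norm (R u) > norm R - \<tau>" and su: "0 \<le> s * apply_c0 u t0"
    using u0 by (auto simp: u_def blinfun.minus_right)
  have su1: "s * apply_c0 u t0 \<le> 1" using \<xi>1[of u] u by linarith
  have "norm (T u + (a * (s * apply_c0 u t0)) *\<^sub>R T f) > 1 + a - 2 * \<eta>"
    using u(2) \<tau> unfolding R by linarith
  from aligned_if_boosted_norm_large(1)[OF _ _ a su su1 this] nT[of u] nT[of f] u f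
  have "1 - s * apply_c0 u t0 < 2 * \<eta> / a" by simp
  also have "\<dots> \<le> 1/4" using \<eta> a by (simp add: field_simps)
  finally have "s * apply_c0 u t0 \<ge> 1/2" by simp
  with stretched_maximiser[OF u(1), of R] s(1)
  obtain w where w: "norm w \<le> 1" "norm (R w) \<ge> 2 * norm (R u) - norm R" "s * apply_c0 w t0 = 1"
    by metis
  have Rw: "norm (R w) > norm R - 2 * \<tau>" using w(2) u(2) by linarith
  then have "norm (T w + (a * 1) *\<^sub>R T f) > 1 + a - 2 * \<eta>"
    using \<tau> R[of w] unfolding w(3) by simp
  from aligned_if_boosted_norm_large(2)[OF _ _ a _ _ this] nT[of w] nT[of f] w f
  have align: "norm (T w + T f) > 2 - 4 * \<eta> / a" by simp
  have "norm R \<ge> 1/4" using N a \<eta> by linarith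
  then have "\<eta>' / 4 \<le> \<eta>' * norm R" using \<eta>' by simp
  then have "norm (R w) > (1 - \<eta>') * norm R"
    using Rw \<tau>(3) by (simp add: algebra_simps)
  with w(1,3) align show thesis by (rule that)
qed

text \<open>
  The new operator is returned in the form \<open>T \<circ> G\<close>, so that every property of \<open>T\<close> stable under
  precomposition is kept; for the theorem this property is compactness.
\<close>

lemma improve_norming:
  assumes uc: "uniformly_convex TYPE('y::real_normed_vector)" and e: "e > 0"
  shows "\<exists>\<eta>>0. \<forall>(T :: ('l::topological_space) c0 \<Rightarrow>\<^sub>L 'y) f.
      norm T = 1 \<and> norm f = 1 \<and> norm (blinfun_apply T f) > 1 - \<eta> \<longrightarrow>
      (\<forall>\<eta>'>0. \<exists>G x0. norm (T o\<^sub>L G) = 1 \<and> norm x0 = 1 \<and> norm (blinfun_apply (T o\<^sub>L G) x0) > 1 - \<eta>' \<and>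
        norm ((T o\<^sub>L G) - T) < e \<and> norm (x0 - f) < e)"
proof -
  \<comment> \<open>The final operator is within \<open>2 * (5 * a)\<close> of \<open>T\<close> and the final point within \<open>4 * b\<close> of \<open>f\<close>.\<close>
  define a where "a = min 1 (e / 20)"
  define b where "b = e / 8"
  have a: "0 < a" "a \<le> 1" "10 * a < e" and b: "0 < b" "4 * b < e"
    using e by (auto simp: a_def b_def)
  obtain d where d: "d > 0"
    "\<And>p q :: 'y. norm p \<le> 1 \<Longrightarrow> norm q \<le> 1 \<Longrightarrow> norm (p + q) > 2 - d \<Longrightarrow> norm (p - q) < 2 * b * a"
    using uniformly_convex_on_ball[OF uc, of "2 * b * a"] a b by (metis mult_pos_pos zero_less_numeral)
  define \<eta> where "\<eta> = min (a * d / 4) (a / 8)"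
  have \<eta>: "0 < \<eta>" "\<eta> \<le> a / 8" "4 * \<eta> / a \<le> d"
    using a d by (auto simp: \<eta>_def field_simps min_def)
  have "\<exists>G x0. norm (T o\<^sub>L G) = 1 \<and> norm x0 = 1 \<and> norm ((T o\<^sub>L G) x0) > 1 - \<eta>' \<and>
        norm ((T o\<^sub>L G) - T) < e \<and> norm (x0 - f) < e"
    if T: "norm T = 1" and f: "norm f = 1" "norm (T f) > 1 - \<eta>" and \<eta>': "\<eta>' > 0"
    for T :: "'l c0 \<Rightarrow>\<^sub>L 'y" and f \<eta>'
  proof -
    obtain t0 s where s: "\<bar>s\<bar> = 1" "s * apply_c0 f t0 = 1" "norm (s *\<^sub>R c0_eval t0) \<le> 1"
      using norming_evaluation[OF f(1)] by metis
    define \<xi> where "\<xi> = s *\<^sub>R c0_eval t0"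
    have \<xi>: "\<xi> x = s * apply_c0 x t0" for x by (simp add: \<xi>_def blinfun.scaleR_left)
    have n\<xi>: "norm \<xi> \<le> 1" using s by (simp add: \<xi>_def)
    define R where "R = T o\<^sub>L boost a f \<xi>"
    obtain w where w: "norm w \<le> 1" "s * apply_c0 w t0 = 1" "norm (T w + T f) > 2 - 4 * \<eta> / a"
      "norm (R w) > (1 - min \<eta>' (1/2)) * norm R"
      using aligned_boosted_near_maximiser[OF T f s a(1,2) \<eta>(1,2), of "min \<eta>' (1/2)"] \<eta>'
      unfolding R_def \<xi>_def by auto
    have nTx: "norm (T x) \<le> 1" if "norm x \<le> 1" for x
      using norm_blinfun[of T x] T that by simp
    have w1: "\<bar>apply_c0 w t\<bar> \<le> 1" and f1: "\<bar>apply_c0 f t\<bar> \<le> 1" for t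
      using c0_abs_le_norm[of w t] c0_abs_le_norm[of f t] w f by linarith+
    \<comment> \<open>\<open>\<psi>\<close> vanishes where \<open>w\<close> and \<open>f\<close> differ by at most \<open>2 * b\<close> and is \<open>1\<close> where they
        differ by at least \<open>4 * b\<close>. Multiplication by \<open>\<psi>\<close> is the operator \<open>D\<close>.\<close>
    define \<psi> where "\<psi> t = max 0 (min 1 (\<bar>apply_c0 (w - f) t\<bar> / (2 * b) - 1))" for t
    have \<psi>: "continuous_on UNIV \<psi>" "\<And>t. 0 \<le> \<psi> t" "\<And>t. \<psi> t \<le> 1"
      unfolding \<psi>_def using b by (auto intro!: continuous_intros)
    have \<psi>0: "\<psi> t = 0" if "\<bar>apply_c0 w t - apply_c0 f t\<bar> \<le> 2 * b" for t
      using that b by (simp add: \<psi>_def field_simps)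
    have \<psi>1: "\<psi> t = 1" if "\<bar>apply_c0 w t - apply_c0 f t\<bar> \<ge> 4 * b" for t
      using that b by (simp add: \<psi>_def field_simps)
    obtain D :: "'l c0 \<Rightarrow>\<^sub>L 'l c0" where D: "\<And>x t. apply_c0 (D x) t = \<psi> t * apply_c0 x t"
      using c0_multiplier[OF \<psi>] by blast
    have D1: "\<bar>apply_c0 (D x) t\<bar> \<le> 1" if "norm x \<le> 1" for x t
      using \<psi>(2,3)[of t] c0_abs_le_norm[of x t] that mult_mono[of "\<psi> t" 1 "\<bar>apply_c0 x t\<bar>" 1]
      by (simp add: D abs_mult)
    have nD: "norm (D x) \<le> 1" if "norm x \<le> 1" for x
      by (rule c0_norm_le) (rule D1[OF that])
    \<comment> \<open>Where \<open>\<psi> \<noteq> 0\<close>, the midpoint \<open>v\<close> of \<open>w\<close> and \<open>f\<close> is at most \<open>1 - b\<close> in absolute value, so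
        \<open>v + b * D x\<close> and \<open>v - b * D x\<close> are both in the ball.\<close>
    have TD: "norm (T (D x)) \<le> a" if x: "norm x \<le> 1" for x
    proof -
      define v where "v = (1/2) *\<^sub>R (w + f)"
      have pm: "norm (v + (r * b) *\<^sub>R D x) \<le> 1" if r: "\<bar>r\<bar> = 1" for r
      proof (rule c0_norm_le)
        fix t
        have *: "\<bar>apply_c0 (v + (r * b) *\<^sub>R D x) t\<bar> \<le> \<bar>(apply_c0 w t + apply_c0 f t) / 2\<bar> + b * \<bar>apply_c0 (D x) t\<bar>"
          using abs_triangle_ineq[of "(apply_c0 w t + apply_c0 f t) / 2" "r * b * apply_c0 (D x) t"] r b
          by (simp add: v_def abs_mult)
        show "\<bar>apply_c0 (v + (r * b) *\<^sub>R D x) t\<bar> \<le> 1"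
        proof (cases "\<bar>apply_c0 w t - apply_c0 f t\<bar> \<le> 2 * b")
          case True
          then have "b * \<bar>apply_c0 (D x) t\<bar> = 0" by (simp add: D \<psi>0)
          then show ?thesis using * w1[of t] f1[of t] by argo
        next
          case False
          have "b * \<bar>apply_c0 (D x) t\<bar> \<le> b * 1" using D1[OF x] b by (intro mult_left_mono) auto
          then show ?thesis using * False w1[of t] f1[of t] by argo
        qed
      qed
      let ?p = "T (v + (1 * b) *\<^sub>R D x)" and ?q = "T (v + (-1 * b) *\<^sub>R D x)"
      have "?p + ?q = T w + T f"
        by (simp add: v_def blinfun.add_right blinfun.diff_right blinfun.scaleR_right algebra_simps
            flip: scaleR_add_left)
      then have "norm (?p - ?q) < 2 * b * a"
        using w(3) \<eta>(3) by (intro d(2) nTx pm) auto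
      moreover have "?p - ?q = (2 * b) *\<^sub>R T (D x)"
        by (simp add: blinfun.add_right blinfun.diff_right blinfun.scaleR_right algebra_simps
            flip: scaleR_add_left)
      ultimately show ?thesis using b by simp
    qed
    have RD: "norm (R (D x)) \<le> 2 * a" if x: "norm x \<le> 1" for x
    proof -
      have "norm (R (D x)) \<le> norm (T (D x)) + a * norm (D x)"
        unfolding R_def by (rule norm_boosted_apply_le) (use nTx f n\<xi> a in auto)
      also have "\<dots> \<le> a + a * 1" using TD[OF x] nD[OF x] a by (intro add_mono mult_left_mono) auto
      finally show ?thesis by simp
    qed
    \<comment> \<open>\<open>E x\<close> is pointwise a convex combination of \<open>x\<close> and \<open>\<xi> x *\<^sub>R w\<close>, hence \<open>E\<close> is a contraction.\<close>
    define E where "E = id_blinfun + (D o\<^sub>L ((blinfun_scaleR_left w o\<^sub>L \<xi>) - id_blinfun))"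
    have E: "E x = x + D (\<xi> x *\<^sub>R w - x)" for x
      by (simp add: E_def blinfun.add_left blinfun.diff_left)
    have Et: "apply_c0 (E x) t = (1 - \<psi> t) * apply_c0 x t + \<psi> t * (\<xi> x * apply_c0 w t)" for x t
      by (simp add: E D algebra_simps)
    have \<xi>x: "\<bar>\<xi> x\<bar> \<le> norm x" for x by (rule functional_abs_le[OF n\<xi>])
    have nE: "norm (E x) \<le> norm x" for x
    proof (rule c0_norm_le)
      fix t
      have 1: "\<bar>\<xi> x * apply_c0 w t\<bar> \<le> norm x * 1"
        unfolding abs_mult by (intro mult_mono \<xi>x w1) auto
      have "\<bar>apply_c0 (E x) t\<bar> \<le> (1 - \<psi> t) * \<bar>apply_c0 x t\<bar> + \<psi> t * \<bar>\<xi> x * apply_c0 w t\<bar>"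
        using abs_triangle_ineq[of "(1 - \<psi> t) * apply_c0 x t" "\<psi> t * (\<xi> x * apply_c0 w t)"] \<psi>(2,3)[of t]
        by (simp add: Et abs_mult)
      also have "\<dots> \<le> (1 - \<psi> t) * norm x + \<psi> t * (norm x * 1)"
        using \<psi>(2,3)[of t] 1 c0_abs_le_norm[of x t] by (intro add_mono mult_left_mono) auto
      finally show "\<bar>apply_c0 (E x) t\<bar> \<le> norm x" by (simp add: algebra_simps)
    qed
    \<comment> \<open>Moving \<open>f\<close> towards \<open>w\<close> by at most \<open>4 * b\<close> reaches \<open>w\<close> wherever \<open>\<psi> < 1\<close>.\<close>
    obtain k where k: "\<And>t. apply_c0 k t = max (-(4*b)) (min (4*b) (apply_c0 (w - f) t))"
      by (rule c0_of_dominated[of "\<lambda>t. max (-(4*b)) (min (4*b) (apply_c0 (w - f) t))" 1 "w - f"])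
        (use b in \<open>auto intro!: continuous_intros\<close>)
    define x0 where "x0 = f + k"
    have x0t: "apply_c0 x0 t = apply_c0 f t + max (-(4*b)) (min (4*b) (apply_c0 w t - apply_c0 f t))" for t
      by (simp add: x0_def k)
    have wf: "apply_c0 w t0 = apply_c0 f t0"
      using w(2) s(1,2) by (metis mult_cancel_left zero_neq_one mult_zero_left)
    have \<xi>x0: "\<xi> x0 = 1" using b s by (simp add: \<xi> x0t wf)
    have nx0: "norm x0 = 1"
    proof (rule antisym)
      show "norm x0 \<le> 1"
      proof (rule c0_norm_le)
        fix t show "\<bar>apply_c0 x0 t\<bar> \<le> 1"
          using w1[of t] f1[of t] b by (simp add: x0t abs_if min_def max_def split: if_splits)
      qed
      show "1 \<le> norm x0" using \<xi>x[of x0] \<xi>x0 by simp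
    qed
    have x0f: "norm (x0 - f) < e"
    proof -
      have "norm (x0 - f) \<le> 4 * b" by (rule c0_norm_le) (use b in \<open>auto simp: x0_def k\<close>)
      then show ?thesis using b by simp
    qed
    have Ex0: "E x0 = w"
    proof (rule c0_eqI)
      fix t
      show "apply_c0 (E x0) t = apply_c0 w t"
      proof (cases "\<bar>apply_c0 w t - apply_c0 f t\<bar> \<ge> 4 * b")
        case True
        then show ?thesis by (simp add: Et \<psi>1 \<xi>x0)
      next
        case False
        then have "apply_c0 x0 t = apply_c0 w t" by (auto simp: x0t)
        then show ?thesis by (simp add: Et \<xi>x0 algebra_simps)
      qed
    qed
    let ?Q = "R o\<^sub>L E"
    have QR: "norm (?Q - R) \<le> 4 * a"
    proof (rule norm_blinfun_bound)
      fix x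
      show "norm ((?Q - R) x) \<le> 4 * a * norm x"
      proof (cases "x = 0")
        case False
        define y where "y = (1 / (2 * norm x)) *\<^sub>R (\<xi> x *\<^sub>R w - x)"
        have "norm (\<xi> x *\<^sub>R w - x) \<le> \<bar>\<xi> x\<bar> * norm w + norm x"
          using norm_triangle_ineq4[of "\<xi> x *\<^sub>R w" x] by simp
        also have "\<dots> \<le> norm x * 1 + norm x"
          by (intro add_mono mult_mono \<xi>x w) auto
        finally have "norm (\<xi> x *\<^sub>R w - x) \<le> 2 * norm x" by simp
        moreover have "norm y = norm (\<xi> x *\<^sub>R w - x) / (2 * norm x)" by (simp add: y_def)
        ultimately have "norm y \<le> 1" using False by simp
        moreover have "\<xi> x *\<^sub>R w - x = (2 * norm x) *\<^sub>R y" using False by (simp add: y_def)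
        then have "(?Q - R) x = (2 * norm x) *\<^sub>R R (D y)"
          by (simp add: blinfun.diff_left E blinfun.add_right blinfun.scaleR_right)
        ultimately show ?thesis using mult_left_mono[OF RD[of y], of "2 * norm x"] by (simp add: algebra_simps)
      qed simp
    qed (use a in simp)
    have "norm (R - T) \<le> a"
      unfolding R_def by (rule norm_boosted_diff_le) (use nTx f n\<xi> a in auto)
    then have QT: "norm (?Q - T) \<le> 5 * a"
      using norm_triangle_ineq[of "?Q - R" "R - T"] QR by simp
    have QR': "norm ?Q \<le> norm R"
    proof (rule norm_blinfun_bound)
      fix x
      show "norm (?Q x) \<le> norm R * norm x"
        using norm_blinfun[of R "E x"] mult_left_mono[OF nE[of x] norm_ge_zero[of R]] by simp
    qed simp
    have "(1 - min \<eta>' (1/2)) * norm ?Q \<le> (1 - min \<eta>' (1/2)) * norm R"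
      using QR' by (intro mult_left_mono) auto
    then have Qx0: "norm (?Q x0) > (1 - min \<eta>' (1/2)) * norm ?Q" using w(4) Ex0 by simp
    have Q0: "?Q \<noteq> 0" using Qx0 by (metis blinfun.zero_left less_irrefl mult_zero_right norm_zero)
    define G where "G = (boost a f \<xi> o\<^sub>L E) /\<^sub>R norm ?Q"
    have TG: "T o\<^sub>L G = ?Q /\<^sub>R norm ?Q"
      by (rule blinfun_eqI) (simp add: G_def R_def blinfun.scaleR_left blinfun.scaleR_right)
    have "norm (T o\<^sub>L G) = 1" using Q0 by (simp add: TG)
    moreover have "norm ((T o\<^sub>L G) x0) > 1 - \<eta>'"
    proof -
      have "norm ((T o\<^sub>L G) x0) = norm (?Q x0) / norm ?Q"
        unfolding TG by (simp add: blinfun.scaleR_left divide_inverse mult.commute)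
      also have "\<dots> > 1 - min \<eta>' (1/2)" using Qx0 Q0 by (simp add: pos_less_divide_eq)
      finally show ?thesis by simp
    qed
    moreover have "norm ((T o\<^sub>L G) - T) < e"
      using norm_rescale_le[OF T QT Q0] a unfolding TG by simp
    ultimately show ?thesis using nx0 x0f by blast
  qed
  then show ?thesis using \<eta>(1) by blast
qed

section \<open>Operators into uniformly convex spaces\<close>

theorem theorem4p2:
  assumes "locally_compact_space (euclidean :: 'l::t2_space topology)"
    and "dimension_at_least 2 TYPE('l c0)"
    and "dimension_at_least 2 TYPE('y::banach)"
    and "uniformly_convex TYPE('y)"
  shows "BPBp_RSE_compact TYPE('l c0) TYPE('y)"
  unfolding BPBp_RSE_compact_def
proof (intro allI impI)
  fix e :: real assume "e > 0"
  define a where "a = min 1 (e / 8)"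
  have a: "0 < a" "a \<le> 1" "2 * a < e / 2" using \<open>e > 0\<close> by (auto simp: a_def)
  have "\<exists>\<eta>>0. \<forall>(T :: 'l c0 \<Rightarrow>\<^sub>L 'y) x. compact_operator T \<and> norm T = 1 \<and> norm x = 1 \<and> norm (T x) > 1 - \<eta> \<longrightarrow>
      (\<exists>S y. compact_operator S \<and> norm S = 1 \<and> norm y = 1 \<and> norm (S y) = 1 \<and>
        norm (S - T) < e / 2 \<and> norm (y - x) < e / 2)"
  proof (rule norm_attainment_by_iteration[OF closed_compact_operators])
    fix e :: real assume "e > 0"
    from improve_norming[OF assms(4) this, where 'l = 'l]
    obtain \<eta> where "\<eta> > 0" and \<eta>: "\<forall>(T :: 'l c0 \<Rightarrow>\<^sub>L 'y) f. norm T = 1 \<and> norm f = 1 \<and>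
        norm (blinfun_apply T f) > 1 - \<eta> \<longrightarrow> (\<forall>\<eta>'>0. \<exists>G x0. norm (T o\<^sub>L G) = 1 \<and> norm x0 = 1 \<and>
          norm (blinfun_apply (T o\<^sub>L G) x0) > 1 - \<eta>' \<and> norm ((T o\<^sub>L G) - T) < e \<and> norm (x0 - f) < e)"
      by (elim exE conjE)
    show "\<exists>\<eta>>0. \<forall>(T :: 'l c0 \<Rightarrow>\<^sub>L 'y) x. compact_operator T \<and> norm T = 1 \<and> norm x = 1 \<and> norm (T x) > 1 - \<eta> \<longrightarrow>
      (\<forall>\<eta>'>0. \<exists>S y. compact_operator S \<and> norm S = 1 \<and> norm y = 1 \<and> norm (S y) > 1 - \<eta>' \<and>
        norm (S - T) < e \<and> norm (y - x) < e)"
    proof (intro exI[of _ \<eta>] conjI allI impI \<open>\<eta> > 0\<close>, elim conjE)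
      fix T :: "'l c0 \<Rightarrow>\<^sub>L 'y" and x and \<eta>' :: real
      assume T: "compact_operator T" "norm T = 1" "norm x = 1" "norm (T x) > 1 - \<eta>" and "\<eta>' > 0"
      from \<eta> T(2,3,4) \<open>\<eta>' > 0\<close> obtain G y where "norm (T o\<^sub>L G) = 1" "norm y = 1"
        "norm (blinfun_apply (T o\<^sub>L G) y) > 1 - \<eta>'" "norm ((T o\<^sub>L G) - T) < e" "norm (y - x) < e"
        by blast
      with compact_operator_compose[OF T(1), of G] show "\<exists>S y. compact_operator S \<and> norm S = 1 \<and> norm y = 1 \<and> norm (S y) > 1 - \<eta>' \<and>
        norm (S - T) < e \<and> norm (y - x) < e" by blast
    qed
  qed (use \<open>e > 0\<close> in simp)
  then obtain \<eta> where "\<eta> > 0" and \<eta>: "\<forall>(T :: 'l c0 \<Rightarrow>\<^sub>L 'y) x.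
      compact_operator T \<and> norm T = 1 \<and> norm x = 1 \<and> norm (T x) > 1 - \<eta> \<longrightarrow>
      (\<exists>S y. compact_operator S \<and> norm S = 1 \<and> norm y = 1 \<and> norm (S y) = 1 \<and>
        norm (S - T) < e / 2 \<and> norm (y - x) < e / 2)"
    by (elim exE conjE)
  have "\<exists>S. \<exists>x0\<in>sphere 0 1. range_strongly_exposing S \<and> compact_operator S \<and>
      norm S = 1 \<and> norm (S x0) = 1 \<and> norm (S - T) < e \<and> norm (x - x0) < e"
    if T: "compact_operator T" "norm T = 1" "norm x = 1" "norm (T x) > 1 - \<eta>"
    for T :: "'l c0 \<Rightarrow>\<^sub>L 'y" and x
  proof -
    obtain S x0 where S: "compact_operator S" "norm S = 1" "norm x0 = 1" "norm (S x0) = 1"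
      and close: "norm (S - T) < e / 2" "norm (x0 - x) < e / 2"
      using \<eta> T by blast
    obtain t s where s: "s * apply_c0 x0 t = 1" "norm (s *\<^sub>R c0_eval t) \<le> 1"
      using norming_evaluation[OF S(3)] by metis
    define \<xi> where "\<xi> = s *\<^sub>R c0_eval t"
    have \<xi>: "norm \<xi> \<le> 1" "\<xi> x0 = 1" using s by (auto simp: \<xi>_def blinfun.scaleR_left)
    let ?R = "S o\<^sub>L boost a x0 \<xi>"
    note nR = norm_boost_attaining[OF S(2,3,4) \<xi> a(1)]
    define Q where "Q = ?R /\<^sub>R norm ?R"
    have R0: "norm ?R > 0" using nR a by simp
    have "range_strongly_exposing Q"
      unfolding Q_def using R0
      by (intro range_strongly_exposing_scaleR range_strongly_exposing_boost assms S \<xi> a) auto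
    moreover have "Q = S o\<^sub>L (boost a x0 \<xi> /\<^sub>R norm ?R)"
      unfolding Q_def by (rule blinfun_eqI) (simp add: blinfun.scaleR_left blinfun.scaleR_right)
    then have "compact_operator Q" using compact_operator_compose[OF S(1)] by metis
    moreover have "norm Q = 1" using R0 by (simp add: Q_def)
    moreover have "norm (Q x0) = 1"
      unfolding Q_def using nR R0 by (simp add: blinfun.scaleR_left)
    moreover have "norm (Q - S) \<le> 2 * a"
      unfolding Q_def
      by (rule norm_rescale_le[OF S(2)], rule norm_boosted_diff_le) (use S \<xi> a R0 in auto)
    then have "norm (Q - T) < e"
      using norm_triangle_ineq[of "Q - S" "S - T"] close a by simp
    moreover have "norm (x - x0) < e" using close \<open>e > 0\<close> by (simp add: norm_minus_commute)
    ultimately show ?thesis using S(3) by (intro exI[of _ Q] bexI[of _ x0]) auto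
  qed
  then show "\<exists>\<eta>>0. \<eta> < e \<and> (\<forall>(T :: 'l c0 \<Rightarrow>\<^sub>L 'y) x. compact_operator T \<and> norm T = 1 \<and>
      x \<in> sphere 0 1 \<and> norm (T x) > 1 - \<eta> \<longrightarrow>
      (\<exists>S. \<exists>x0\<in>sphere 0 1. range_strongly_exposing S \<and> compact_operator S \<and>
        norm S = 1 \<and> norm (S x0) = 1 \<and> norm (S - T) < e \<and> norm (x - x0) < e))"
    using \<open>\<eta> > 0\<close> \<open>e > 0\<close> by (intro exI[of _ "min \<eta> (e / 2)"]) auto
qed

end
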